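(* Let $H$ be a numerical semigroup, let $n$ be a nonzero element of $H$, and let $t=\mathrm{t}(H)$ be the type of $H$. Put $m=n-t$ and write the Apéry set as $$\mathrm{Ap}(H,n)=\{0<\alpha_1<\cdots<\alpha_m\}\cup\{\beta_1<\beta_2<\cdots<\beta_{t-1}\},$$ where the elements are labelled so that $\mathrm{PF}(H)=\{\beta_i-n \mid 1\le i\le t-1\}\cup\{\alpha_m-n\}$ and $\alpha_m-n=\mathrm{F}(H)$. Put $f_i=\beta_i-n$ for $1\le i\le t-1$ and $f_t=\alpha_m-n=\mathrm{F}(H)$. Then the following conditions are equivalent: (1) $H$ is almost symmetric; (2) $\alpha_i+\alpha_{m-i}=\alpha_m$ for all $i\in\{1,2,\dots,m-1\}$ and $\beta_j+\beta_{t-j}=\alpha_m+n$ for all $j\in\{1,2,\dots,t-1\}$; (3) $f_i+f_{t-i}=\mathrm{F}(H)$ for all $i\in\{1,2,\dots,t-1\}$.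
   Context: A numerical semigroup is a subset $H\subseteq\mathbb{N}=\{0,1,2,\dots\}$ containing $0$, closed under addition, with $\mathbb{N}\setminus H$ finite. $\mathrm{g}(H)=|\mathbb{N}\setminus H|$ is its genus and $\mathrm{F}(H)$ is the largest integer not in $H$ (so $\mathrm{F}(\mathbb{N})=-1$). $\mathrm{PF}(H)=\{x\in\mathbb{Z}\setminus H \mid x+h\in H\text{ for all }h\in H,\ h\neq 0\}$ is the set of pseudo-Frobenius numbers, and $\mathrm{t}(H)=|\mathrm{PF}(H)|$ is the type. For nonzero $n\in H$, $\mathrm{Ap}(H,n)=\{h\in H\mid h-n\notin H\}$; it has exactly $n$ elements, and $x+n\in \mathrm{Ap}(H,n)$ for every $x\in\mathrm{PF}(H)$. Thus the $\beta_i$ are the elements $x+n$ with $x\in\mathrm{PF}(H)\setminus\{\mathrm{F}(H)\}$, and the $\alpha_i$ are the remaining nonzero elements (with the convention $\alpha_0=0$, relevant only if $m=0$). $H$ is almost symmetric if $2\mathrm{g}(H)=\mathrm{F}(H)+\mathrm{t}(H)$; equivalently, for every integer $z\notin H$, either $\mathrm{F}(H)-z\in H$ or $z\in\mathrm{PF}(H)$. *)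

theory Defs
  imports Main
begin

definition numerical_semigroup :: "nat set \<Rightarrow> bool" where
  "numerical_semigroup H \<longleftrightarrow>
     0 \<in> H \<and> (\<forall>x\<in>H. \<forall>y\<in>H. x + y \<in> H) \<and> finite (- H)"

definition genus :: "nat set \<Rightarrow> nat" where
  "genus H = card (- H)"

text \<open>The greatest element is taken over all integers, so that the Frobenius number
  of \<open>UNIV\<close> is \<open>-1\<close>.\<close>

definition frobenius_number :: "nat set \<Rightarrow> int" where
  "frobenius_number H = (GREATEST z. z \<notin> int ` H)"

definition pseudo_frobenius :: "nat set \<Rightarrow> int set" where
  "pseudo_frobenius H = {x. x \<notin> int ` H \<and> (\<forall>h\<in>H. h \<noteq> 0 \<longrightarrow> x + int h \<in> int ` H)}"

definition semigroup_type :: "nat set \<Rightarrow> nat" where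
  "semigroup_type H = card (pseudo_frobenius H)"

definition apery :: "nat set \<Rightarrow> nat \<Rightarrow> nat set" where
  "apery H n = {h \<in> H. int h - int n \<notin> int ` H}"

definition almost_symmetric :: "nat set \<Rightarrow> bool" where
  "almost_symmetric H \<longleftrightarrow>
     2 * int (genus H) = frobenius_number H + int (semigroup_type H)"

end

theory Submission imports Defs begin

text \<open>
  Put \<open>L = {z. z \<notin> H \<and> F - z \<notin> H}\<close>.  Reflection in \<open>F\<close> gives \<open>2g = F + 1 + |L|\<close>, and
  \<open>PF - {F} \<subseteq> L\<close>, so \<open>H\<close> is almost symmetric iff \<open>L = PF - {F}\<close>.  The set \<open>L\<close> is symmetric under
  \<open>z \<mapsto> F - z\<close>, and an increasing enumeration of a symmetric set satisfies the pairing identities;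
  this gives (3), and likewise (2), since the \<open>\<alpha>\<^sub>i\<close> are then symmetric under \<open>a \<mapsto> \<alpha>\<^sub>m - a\<close>.
  Conversely, for \<open>z \<in> L\<close> pick \<open>f \<in> PF\<close> with \<open>f - z \<in> H\<close>.  Then \<open>f \<noteq> F\<close>, so \<open>F - f \<in> PF\<close> by (3),
  and \<open>F - z = (F - f) + (f - z) \<notin> H\<close> forces \<open>z = f\<close>.
\<close>

section \<open>Increasing enumerations of reflection-invariant sets\<close>

lemma strict_antimono_self_map_atLeastAtMost:
  fixes \<sigma> :: "nat \<Rightarrow> nat"
  assumes maps: "\<And>i. i \<in> {a..b} \<Longrightarrow> \<sigma> i \<in> {a..b}"
    and anti: "\<And>i j. \<lbrakk>i \<in> {a..b}; j \<in> {a..b}; i < j\<rbrakk> \<Longrightarrow> \<sigma> j < \<sigma> i"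
    and i: "i \<in> {a..b}"
  shows "\<sigma> i = a + b - i"
proof (rule antisym)
  \<comment> \<open>Values drop by at least one per step, so counting from the left end bounds
    \<open>\<sigma>\<close> above, and counting from the right end (\<open>lower\<close>) bounds it
    below.\<close>
  have upper: "\<sigma> (a + k) + k \<le> b" if "a + k \<le> b" for k
    using that
  proof (induction k)
    case 0
    then show ?case using maps[of a] by simp
  next
    case (Suc k)
    then show ?case using anti[of "a + k" "a + Suc k"] by simp
  qed
  have lower: "a + k \<le> \<sigma> (b - k)" if "a + k \<le> b" for k
    using that
  proof (induction k)
    case 0
    then show ?case using maps[of b] by simp
  next
    case (Suc k)
    moreover have "\<sigma> (b - k) < \<sigma> (b - Suc k)" using Suc.prems by (intro anti) auto
    ultimately show ?case by simp
  qed
  show "\<sigma> i \<le> a + b - i" using upper[of "i - a"] i by simp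
  show "a + b - i \<le> \<sigma> i" using lower[of "b - i"] i by (simp add: le_diff_conv)
qed

text \<open>Pulled back along \<open>g\<close>, the reflection x -> c - x becomes an order-reversing
  self-map of the index interval, and the only such map is i -> a + b - i.\<close>

lemma strict_mono_on_reflection:
  fixes g :: "nat \<Rightarrow> 'a::linordered_idom"
  assumes mono: "strict_mono_on {a..b} g"
    and refl: "\<And>i. i \<in> {a..b} \<Longrightarrow> c - g i \<in> g ` {a..b}"
    and i: "i \<in> {a..b}"
  shows "g i + g (a + b - i) = c"
proof -
  have "\<forall>i\<in>{a..b}. \<exists>j\<in>{a..b}. g j = c - g i"
    using refl by (metis imageE)
  then obtain \<sigma> where \<sigma>: "\<And>i. i \<in> {a..b} \<Longrightarrow> \<sigma> i \<in> {a..b} \<and> g (\<sigma> i) = c - g i"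
    by metis
  have "\<sigma> i = a + b - i"
  proof (rule strict_antimono_self_map_atLeastAtMost[OF _ _ i])
    show "\<sigma> i \<in> {a..b}" if "i \<in> {a..b}" for i using \<sigma>[OF that] by simp
    show "\<sigma> j < \<sigma> i" if "i \<in> {a..b}" "j \<in> {a..b}" "i < j" for i j
    proof -
      have "g (\<sigma> j) < g (\<sigma> i)"
        using strict_mono_onD[OF mono that] \<sigma>[OF that(1)] \<sigma>[OF that(2)] by simp
      then show ?thesis
        using strict_mono_on_less[OF mono] \<sigma>[OF that(1)] \<sigma>[OF that(2)] by blast
    qed
  qed
  then show ?thesis using \<sigma>[OF i] by simp
qed

section \<open>Frobenius number and a genus formula\<close>

lemma numerical_semigroup_add:
  assumes "numerical_semigroup H" "x \<in> int ` H" "y \<in> int ` H"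
  shows "x + y \<in> int ` H"
  using assms unfolding numerical_semigroup_def by (auto simp flip: of_nat_add)

lemma frobenius_number_greatest:
  assumes H: "numerical_semigroup H"
  shows frobenius_number_notin: "frobenius_number H \<notin> int ` H"
    and le_frobenius_number: "z \<notin> int ` H \<Longrightarrow> z \<le> frobenius_number H"
proof -
  \<comment> \<open>The element -1 stands in for all negative integers and keeps \<open>G\<close>
    nonempty when \<open>H\<close> is \<open>UNIV\<close>.\<close>
  define G where "G = insert (-1) (int ` (- H))"
  have fin: "finite G"
    using H by (simp add: G_def numerical_semigroup_def)
  have notin: "z \<notin> int ` H" if "z \<in> G" for z
    using that by (auto simp: G_def)
  have le: "z \<le> Max G" if "z \<notin> int ` H" for z
  proof (cases "z \<ge> 0")
    case True
    then have "z \<in> G"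
      using that by (metis ComplI G_def image_eqI insertCI nonneg_int_cases)
    then show ?thesis using fin by simp
  next
    case False
    then have "z \<le> -1" by simp
    also have "-1 \<le> Max G" using fin by (simp add: G_def)
    finally show ?thesis .
  qed
  have Max: "Max G \<notin> int ` H"
    using fin by (intro notin Max_in) (auto simp: G_def)
  then have "frobenius_number H = Max G"
    unfolding frobenius_number_def using le by (intro Greatest_equality) auto
  then show "frobenius_number H \<notin> int ` H"
    and "z \<notin> int ` H \<Longrightarrow> z \<le> frobenius_number H"
    using Max le by simp_all
qed

lemma frobenius_number_ge:
  assumes "numerical_semigroup H"
  shows "-1 \<le> frobenius_number H"
  by (rule le_frobenius_number[OF assms]) auto

text \<open>This is the set L of the overview; it is empty exactly for symmetric semigroups. It
  omits F itself, since F - F = 0 lies in \<open>H\<close>.\<close>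

definition symmetry_defect :: "nat set \<Rightarrow> int set" where
  "symmetry_defect H = {z. z \<notin> int ` H \<and> frobenius_number H - z \<notin> int ` H}"

lemma symmetry_defect_subset:
  assumes "numerical_semigroup H"
  shows "symmetry_defect H \<subseteq> {0..frobenius_number H}"
  using le_frobenius_number[OF assms] by (fastforce simp: symmetry_defect_def)

text \<open>Reflection in F sends the elements of \<open>H\<close> in [0, F] injectively to gaps,
  and the gaps missed are those in L. Hence g = |S| + |L|, while |S| + g = F + 1.\<close>

lemma two_genus_eq:
  assumes H: "numerical_semigroup H"
  shows "2 * int (genus H) = frobenius_number H + 1 + int (card (symmetry_defect H))"
proof -
  define F where "F = frobenius_number H"
  define S where "S = int ` H \<inter> {0..F}"
  define N where "N = int ` (- H)"
  note F_notin = frobenius_number_notin[OF H, folded F_def]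
    and le_F = le_frobenius_number[OF H, folded F_def]
  have nonmember: "z \<in> N \<longleftrightarrow> z \<notin> int ` H \<and> z \<in> {0..F}" for z
  proof
    assume "z \<in> N"
    then have "z \<notin> int ` H" "0 \<le> z" by (auto simp: N_def)
    then show "z \<notin> int ` H \<and> z \<in> {0..F}" using le_F[of z] by simp
  next
    assume "z \<notin> int ` H \<and> z \<in> {0..F}"
    then show "z \<in> N"
      unfolding N_def by (metis ComplI atLeastAtMost_iff image_eqI nonneg_int_cases)
  qed
  have finL: "finite (symmetry_defect H)"
    using symmetry_defect_subset[OF H] finite_subset by blast
  have finS: "finite S" by (simp add: S_def)
  have finN: "finite N" using H by (simp add: N_def numerical_semigroup_def)
  have "S \<union> N = {0..F}" "S \<inter> N = {}"
    using nonmember by (auto simp: S_def)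
  \<comment> \<open>The bound -1 \<le> F gives [0, F] exactly F + 1 elements, also when it is
    empty.\<close>
  then have interval: "int (card S) + int (card N) = F + 1"
    using card_Un_disjoint[OF finS finN] frobenius_number_ge[OF H] by (simp add: F_def)
  have refl_notin: "F - s \<notin> int ` H" if "s \<in> int ` H" for s
    using numerical_semigroup_add[OF H _ that, of "F - s"] F_notin by auto
  have "N = (\<lambda>s. F - s) ` S \<union> symmetry_defect H" (is "_ = ?R \<union> ?L")
  proof (intro equalityI subsetI)
    fix z assume z: "z \<in> N"
    show "z \<in> ?R \<union> ?L"
    proof (cases "F - z \<in> int ` H")
      case True
      then have "F - z \<in> S" using z nonmember by (auto simp: S_def)
      then show ?thesis by (intro UnI1 image_eqI[of _ _ "F - z"]) auto
    next
      case False
      then show ?thesis using z nonmember by (simp add: symmetry_defect_def F_def)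
    qed
  next
    fix z assume "z \<in> ?R \<union> ?L"
    then show "z \<in> N"
    proof
      assume "z \<in> ?R"
      then obtain s where "s \<in> int ` H" "s \<in> {0..F}" "z = F - s"
        unfolding S_def by blast
      then show ?thesis using refl_notin nonmember by simp
    next
      assume z: "z \<in> ?L"
      then have "z \<in> {0..F}" using symmetry_defect_subset[OF H] by (auto simp: F_def)
      then show ?thesis using z nonmember by (simp add: symmetry_defect_def)
    qed
  qed
  moreover have "?R \<inter> ?L = {}"
    by (auto simp: S_def symmetry_defect_def F_def)
  moreover have "card ?R = card S"
    by (rule card_image) (simp add: inj_on_def)
  ultimately have "card N = card S + card ?L"
    using finS finL by (simp add: card_Un_disjoint)
  moreover have "card N = genus H"
    by (simp add: N_def genus_def card_image)
  ultimately show ?thesis using interval by (simp add: F_def)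
qed

section \<open>Almost symmetry as reflection invariance of the pseudo-Frobenius numbers\<close>

lemma pseudo_frobenius_add:
  assumes "x \<in> pseudo_frobenius H" "y \<in> int ` H" "y \<noteq> 0"
  shows "x + y \<in> int ` H"
  using assms by (auto simp: pseudo_frobenius_def)

lemma frobenius_number_in_pseudo_frobenius:
  assumes "numerical_semigroup H"
  shows "frobenius_number H \<in> pseudo_frobenius H"
  using frobenius_number_notin[OF assms] le_frobenius_number[OF assms]
  by (fastforce simp: pseudo_frobenius_def)

text \<open>If F - x were in \<open>H\<close>, it would be nonzero, and F = x + (F - x) would lie in
  \<open>H\<close>.\<close>

lemma pseudo_frobenius_subset_symmetry_defect:
  assumes H: "numerical_semigroup H"
  shows "pseudo_frobenius H - {frobenius_number H} \<subseteq> symmetry_defect H"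
proof
  fix x assume x: "x \<in> pseudo_frobenius H - {frobenius_number H}"
  then have "frobenius_number H - x \<notin> int ` H"
    using pseudo_frobenius_add[of x H "frobenius_number H - x"] frobenius_number_notin[OF H]
    by auto
  then show "x \<in> symmetry_defect H"
    using x by (simp add: symmetry_defect_def pseudo_frobenius_def)
qed

text \<open>By the genus formula almost symmetry says |L| = t - 1, and an inclusion of finite sets
  of equal size is an equality.\<close>

lemma almost_symmetric_iff:
  assumes H: "numerical_semigroup H"
  shows "almost_symmetric H \<longleftrightarrow>
    symmetry_defect H = pseudo_frobenius H - {frobenius_number H}" (is "_ \<longleftrightarrow> ?L = ?P")
proof -
  have sub: "?P \<subseteq> ?L" by (rule pseudo_frobenius_subset_symmetry_defect[OF H])
  have finL: "finite ?L"
    using symmetry_defect_subset[OF H] finite_subset by blast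
  then have "finite ?P" using sub finite_subset by blast
  then have "card (pseudo_frobenius H) = Suc (card ?P)"
    using card_Suc_Diff1[OF _ frobenius_number_in_pseudo_frobenius[OF H]] by simp
  then have "almost_symmetric H \<longleftrightarrow> card ?L = card ?P"
    using two_genus_eq[OF H] by (simp add: almost_symmetric_def semigroup_type_def)
  also have "\<dots> \<longleftrightarrow> ?L = ?P"
    using card_subset_eq[OF finL sub] by metis
  finally show ?thesis .
qed

text \<open>Pseudo-Frobenius numbers are the maximal integers outside \<open>H\<close> for the order
  in which w is below w' iff w' - w is in \<open>H\<close>. Everything outside \<open>H\<close> is
  bounded by F, so a maximal one exists above z.\<close>

lemma pseudo_frobenius_above:
  assumes H: "numerical_semigroup H" and z: "z \<notin> int ` H"
  obtains f where "f \<in> pseudo_frobenius H" "f - z \<in> int ` H"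
proof -
  define D where "D = {w. w \<notin> int ` H \<and> w - z \<in> int ` H}"
  have "D \<subseteq> {z..frobenius_number H}"
    using le_frobenius_number[OF H] by (force simp: D_def)
  then have fin: "finite D" using finite_subset by blast
  have "z \<in> D"
    using z H by (auto simp: D_def numerical_semigroup_def)
  then have Max: "Max D \<in> D" using Max_in[OF fin] by blast
  have "Max D + int h \<in> int ` H" if h: "h \<in> H" "h \<noteq> 0" for h
  proof (rule ccontr)
    assume notin: "Max D + int h \<notin> int ` H"
    have "(Max D - z) + int h \<in> int ` H"
      using Max h numerical_semigroup_add[OF H] by (simp add: D_def)
    then have "Max D + int h \<in> D"
      using notin by (simp add: D_def algebra_simps)
    then have "Max D + int h \<le> Max D" using fin by (rule Max_ge[rotated])
    then show False using h by simp
  qed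
  then have "Max D \<in> pseudo_frobenius H"
    using Max by (simp add: pseudo_frobenius_def D_def)
  then show ?thesis using that Max by (simp add: D_def)
qed

text \<open>This eliminates L, leaving a condition on PF alone that becomes (3) once PF is
  enumerated.\<close>

lemma almost_symmetric_iff_reflection:
  assumes H: "numerical_semigroup H"
  shows "almost_symmetric H \<longleftrightarrow>
    (\<forall>x \<in> pseudo_frobenius H - {frobenius_number H}.
       frobenius_number H - x \<in> pseudo_frobenius H - {frobenius_number H})"
    (is "_ \<longleftrightarrow> ?R")
proof
  assume "almost_symmetric H"
  then have L: "symmetry_defect H = pseudo_frobenius H - {frobenius_number H}"
    using almost_symmetric_iff[OF H] by simp
  show ?R
    unfolding L[symmetric] by (simp add: symmetry_defect_def)
next
  assume R: ?R
  have "z \<in> pseudo_frobenius H - {frobenius_number H}" if z: "z \<in> symmetry_defect H" for z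
  proof -
    obtain f where f: "f \<in> pseudo_frobenius H" "f - z \<in> int ` H"
      using pseudo_frobenius_above[OF H] z by (auto simp: symmetry_defect_def)
    then have "f \<noteq> frobenius_number H"
      using z by (auto simp: symmetry_defect_def)
    then have "frobenius_number H - f \<in> pseudo_frobenius H" using R f by simp
    from pseudo_frobenius_add[OF this f(2)] have "f - z = 0"
      using z by (auto simp: symmetry_defect_def)
    then show ?thesis using f \<open>f \<noteq> frobenius_number H\<close> by simp
  qed
  then show "almost_symmetric H"
    using almost_symmetric_iff[OF H] pseudo_frobenius_subset_symmetry_defect[OF H] by blast
qed

section \<open>Residue classes and the size of the Apery set\<close>

lemma card_apery_ge:
  assumes H: "numerical_semigroup H" and n: "n \<noteq> 0" and fin: "finite (apery H n)"
  shows "n \<le> card (apery H n)"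
proof -
  have "{..<n} \<subseteq> (\<lambda>h. h mod n) ` apery H n"
  proof
    fix r assume r: "r \<in> {..<n}"
    \<comment> \<open>The witness for the class r is its least element in \<open>H\<close>:
      subtracting n stays in the class, so by minimality it leaves \<open>H\<close>.\<close>
    define P where "P h \<longleftrightarrow> h \<in> H \<and> h mod n = r" for h
    have "infinite (range (\<lambda>k. r + n * k))"
      using n by (subst finite_image_iff) (simp_all add: inj_def)
    moreover have "finite (- H)" using H by (simp add: numerical_semigroup_def)
    ultimately have "\<not> range (\<lambda>k. r + n * k) \<subseteq> - H" using finite_subset by blast
    then obtain k where "r + n * k \<in> H" by blast
    then have "P (r + n * k)" using r by (simp add: P_def)
    then have least: "P (Least P)" by (rule LeastI)
    have "Least P \<in> apery H n"
    proof (rule ccontr)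
      assume "Least P \<notin> apery H n"
      then obtain h where h: "h \<in> H" "int (Least P) - int n = int h"
        using least by (auto simp: apery_def P_def)
      then have eq: "Least P = h + n" by simp
      then have "P h" using least h(1) unfolding P_def by (metis mod_add_self2)
      then have "Least P \<le> h" by (rule Least_le)
      then show False using eq n by simp
    qed
    then show "r \<in> (\<lambda>h. h mod n) ` apery H n"
      using least by (intro image_eqI[of _ _ "Least P"]) (auto simp: P_def)
  qed
  then have "card {..<n} \<le> card ((\<lambda>h. h mod n) ` apery H n)"
    using fin by (intro card_mono) auto
  also have "\<dots> \<le> card (apery H n)" using fin by (rule card_image_le)
  finally show ?thesis by simp
qed

theorem theorem2p4:
  fixes H :: "nat set" and n t m :: nat
    and \<alpha> \<beta> :: "nat \<Rightarrow> nat" and f :: "nat \<Rightarrow> int"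
  assumes "numerical_semigroup H"
    and "n \<in> H" and "n \<noteq> 0"
    and "t = semigroup_type H"
    and "int m = int n - int t"
    and "\<alpha> 0 = 0"
    and "strict_mono_on {0..m} \<alpha>"
    and "strict_mono_on {1..t - 1} \<beta>"
    and "apery H n = \<alpha> ` {0..m} \<union> \<beta> ` {1..t - 1}"
    and "pseudo_frobenius H =
           {int (\<beta> i) - int n | i. i \<in> {1..t - 1}} \<union> {int (\<alpha> m) - int n}"
    and "int (\<alpha> m) - int n = frobenius_number H"
    and "\<forall>i\<in>{1..t - 1}. f i = int (\<beta> i) - int n"
    and "f t = int (\<alpha> m) - int n"
  shows "(almost_symmetric H \<longleftrightarrow>
            (\<forall>i\<in>{1..m - 1}. \<alpha> i + \<alpha> (m - i) = \<alpha> m) \<and>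
            (\<forall>j\<in>{1..t - 1}. \<beta> j + \<beta> (t - j) = \<alpha> m + n)) \<and>
         (almost_symmetric H \<longleftrightarrow>
            (\<forall>i\<in>{1..t - 1}. f i + f (t - i) = frobenius_number H))"
proof -
  note H = assms(1) and \<alpha>0 = assms(6) and \<alpha>_mono = assms(7) and \<beta>_mono = assms(8)
    and Ap = assms(9) and PF = assms(10) and F = assms(11) and f = assms(12)
  define Q where "Q = pseudo_frobenius H - {frobenius_number H}"
  have inj_\<alpha>: "inj_on \<alpha> {0..m}" and inj_\<beta>: "inj_on \<beta> {1..t - 1}"
    using \<alpha>_mono \<beta>_mono by (auto intro: strict_mono_on_imp_inj_on)
  have PF_image: "pseudo_frobenius H = insert (frobenius_number H) (f ` {1..t - 1})"
    unfolding PF F using f by (auto simp: image_def)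
  then have "finite (pseudo_frobenius H)" "pseudo_frobenius H \<noteq> {}" by auto
  then have "t > 0"
    using assms(4) by (simp add: semigroup_type_def card_gt_0_iff)
  \<comment> \<open>A count: PF has t elements, but f takes at most t - 1 values on the index
    range.\<close>
  have F_notin_f: "frobenius_number H \<notin> f ` {1..t - 1}"
  proof
    assume "frobenius_number H \<in> f ` {1..t - 1}"
    then have "pseudo_frobenius H = f ` {1..t - 1}"
      using PF_image by (simp add: insert_absorb)
    then have "t \<le> t - 1"
      using assms(4) card_image_le[of "{1..t - 1}" f] by (simp add: semigroup_type_def)
    then show False using \<open>t > 0\<close> by simp
  qed
  then have Q: "Q = f ` {1..t - 1}" using PF_image by (auto simp: Q_def)
  \<comment> \<open>Again a count: the two lists have (m + 1) + (t - 1) = n entries, and their union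
    has at least n elements.\<close>
  have disjoint: "\<alpha> ` {0..m} \<inter> \<beta> ` {1..t - 1} = {}"
  proof -
    have "card (\<alpha> ` {0..m}) + card (\<beta> ` {1..t - 1}) = n"
      using card_image[OF inj_\<alpha>] card_image[OF inj_\<beta>] assms(5) \<open>t > 0\<close> by simp
    moreover have "n \<le> card (apery H n)"
      by (rule card_apery_ge[OF H assms(3)]) (simp add: Ap)
    ultimately show ?thesis
      using card_Un_Int[of "\<alpha> ` {0..m}" "\<beta> ` {1..t - 1}"] Ap by simp
  qed

  have one_three: "almost_symmetric H \<longleftrightarrow>
      (\<forall>i\<in>{1..t - 1}. f i + f (t - i) = frobenius_number H)" (is "_ \<longleftrightarrow> ?three")
  proof
    assume "almost_symmetric H"
    then have refl: "\<forall>x\<in>Q. frobenius_number H - x \<in> Q"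
      using almost_symmetric_iff_reflection[OF H] by (simp add: Q_def)
    have mono: "strict_mono_on {1..t - 1} f"
      using \<beta>_mono f by (auto simp: strict_mono_on_def)
    show ?three
    proof
      fix i assume i: "i \<in> {1..t - 1}"
      have "f i + f (1 + (t - 1) - i) = frobenius_number H"
        using refl by (intro strict_mono_on_reflection[OF mono _ i]) (simp add: Q)
      then show "f i + f (t - i) = frobenius_number H" using \<open>t > 0\<close> by simp
    qed
  next
    assume three: ?three
    have "frobenius_number H - x \<in> Q" if x: "x \<in> Q" for x
    proof -
      obtain i where i: "i \<in> {1..t - 1}" "x = f i" using x Q by auto
      then have "frobenius_number H - x = f (t - i)" using three by (simp add: algebra_simps)
      moreover have "t - i \<in> {1..t - 1}" using i by auto
      ultimately show ?thesis using Q by simp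
    qed
    then show "almost_symmetric H"
      using almost_symmetric_iff_reflection[OF H] by (simp add: Q_def)
  qed

  \<comment> \<open>Adding 2n to both sides turns F into \<alpha>_m + n.\<close>
  have f_\<beta>: "f j + f (t - j) = frobenius_number H \<longleftrightarrow> \<beta> j + \<beta> (t - j) = \<alpha> m + n"
    if "j \<in> {1..t - 1}" for j
  proof -
    have "t - j \<in> {1..t - 1}" using that by auto
    then have "f j = int (\<beta> j) - int n" "f (t - j) = int (\<beta> (t - j)) - int n"
      using f that by blast+
    then show ?thesis using F by linarith
  qed

  \<comment> \<open>The index range includes 0 and m so that the set of all \<alpha>_i is invariant
    under a -> \<alpha>_m - a, which swaps the endpoints 0 and \<alpha>_m.\<close>
  have \<alpha>_pairing: "\<alpha> i + \<alpha> (m - i) = \<alpha> m"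
    if as: "almost_symmetric H" and i: "i \<in> {0..m}" for i
  proof -
    have "int (\<alpha> m) - int (\<alpha> i) \<in> (\<lambda>i. int (\<alpha> i)) ` {0..m}" if i: "i \<in> {0..m}" for i
    proof (cases "i = 0 \<or> i = m")
      case True
      then show ?thesis using \<alpha>0 by force
    next
      case False
      define a where "a = int (\<alpha> i)"
      have pos: "a > 0"
        using strict_mono_onD[OF \<alpha>_mono, of 0 i] i False \<alpha>0 by (simp add: a_def)
      have "\<alpha> i \<in> apery H n" using i Ap by blast
      then have a: "a \<in> int ` H" "a - int n \<notin> int ` H"
        by (auto simp: apery_def a_def)
      have "a \<noteq> int (\<alpha> m)"
        using inj_\<alpha> i False by (auto simp: a_def inj_on_def)
      moreover have "a \<noteq> int (\<beta> j)" if "j \<in> {1..t - 1}" for j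
        using disjoint i that unfolding a_def of_nat_eq_iff by blast
      \<comment> \<open>Being neither some \<beta>_j nor \<alpha>_m, a gives a - n outside PF, hence
        outside L; so the reflection \<alpha>_m - a of a - n falls into \<open>H\<close>.\<close>
      ultimately have "a - int n \<notin> pseudo_frobenius H"
        using PF by auto
      then have "a - int n \<notin> symmetry_defect H"
        using as almost_symmetric_iff[OF H] by simp
      then have "frobenius_number H - (a - int n) \<in> int ` H"
        using a(2) unfolding symmetry_defect_def by blast
      moreover have "frobenius_number H - (a - int n) = int (\<alpha> m) - a"
        using F by linarith
      ultimately have "int (\<alpha> m) - a \<in> int ` H" by metis
      then obtain h where h: "h \<in> H" "int (\<alpha> m) - a = int h" by auto
      \<comment> \<open>Otherwise F = (h - n) + a would be a sum of two elements of
        \<open>H\<close>.\<close>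
      have "int h - int n \<notin> int ` H"
      proof
        assume "int h - int n \<in> int ` H"
        from numerical_semigroup_add[OF H this a(1)] show False
          using h F frobenius_number_notin[OF H] by (simp add: algebra_simps)
      qed
      then have "h \<in> apery H n" using h by (simp add: apery_def)
      \<comment> \<open>The same sum again: if h - n were in PF, adding the nonzero a would put F
        into \<open>H\<close>.\<close>
      moreover have "h \<notin> \<beta> ` {1..t - 1}"
      proof
        assume "h \<in> \<beta> ` {1..t - 1}"
        then have "int h - int n \<in> pseudo_frobenius H" using PF by auto
        from pseudo_frobenius_add[OF this a(1)] show False
          using pos h F frobenius_number_notin[OF H] by (simp add: algebra_simps)
      qed
      ultimately have "h \<in> \<alpha> ` {0..m}" using Ap by blast
      then show ?thesis using h by (auto simp: a_def)
    qed
    moreover have "strict_mono_on {0..m} (\<lambda>i. int (\<alpha> i))"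
      using \<alpha>_mono by (simp add: strict_mono_on_def)
    ultimately have "int (\<alpha> i) + int (\<alpha> (0 + m - i)) = int (\<alpha> m)"
      using i by (intro strict_mono_on_reflection) auto
    then show ?thesis by simp
  qed

  have \<alpha>_all: "\<forall>i\<in>{1..m - 1}. \<alpha> i + \<alpha> (m - i) = \<alpha> m" if "almost_symmetric H"
    using \<alpha>_pairing[OF that] by force
  have two_three: "(\<forall>i\<in>{1..t - 1}. f i + f (t - i) = frobenius_number H) \<longleftrightarrow>
      (\<forall>j\<in>{1..t - 1}. \<beta> j + \<beta> (t - j) = \<alpha> m + n)"
    by (intro ball_cong refl f_\<beta>)
  \<comment> \<open>The \<beta> half of (2) is (3), hence (1), and (1) yields the \<alpha>
    half.\<close>
  show ?thesis
    unfolding two_three[symmetric] one_three[symmetric] using \<alpha>_all by blast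
qed

end
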